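(* Let $f:\mathbb{R}^2\to\mathbb{R}^2$ be a $C^1$ vector field whose flow $\phi_t$ is defined for all $t\ge0$, and suppose that $\dot x=f(x)$ is nonexpansive on $\mathbb{R}^2$ with respect to a norm $\|\cdot\|$ which is not a weighted $\ell^2$ norm. Then every bounded trajectory converges to the set of equilibria: if $\{\phi_t(x):t\ge0\}$ is bounded, then the distance from $\phi_t(x)$ to $\{p\in\mathbb{R}^2: f(p)=0\}$ tends to $0$ as $t\to\infty$.
   Context: The system is nonexpansive with respect to $\|\cdot\|$ if $\|\phi_t(x)-\phi_t(y)\|\le\|x-y\|$ for all $x,y$ and all $t>0$. A weighted $\ell^2$ norm on $\mathbb{R}^2$ is a norm of the form $\|x\|=\sqrt{x^\top P x}$ with $P$ a symmetric positive definite real matrix. The norm is not assumed strictly convex. *)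

theory Defs
  imports "HOL-Analysis.Analysis"
begin

definition is_norm :: "('a::real_vector \<Rightarrow> real) \<Rightarrow> bool" where
  "is_norm N \<longleftrightarrow>
     (\<forall>x. 0 \<le> N x) \<and>
     (\<forall>x. N x = 0 \<longleftrightarrow> x = 0) \<and>
     (\<forall>c x. N (c *\<^sub>R x) = \<bar>c\<bar> * N x) \<and>
     (\<forall>x y. N (x + y) \<le> N x + N y)"

definition sym_pos_def :: "real ^ 'n ^ 'n \<Rightarrow> bool" where
  "sym_pos_def P \<longleftrightarrow> transpose P = P \<and> (\<forall>x. x \<noteq> 0 \<longrightarrow> 0 < x \<bullet> (P *v x))"

definition weighted_l2_norm :: "(real ^ 'n \<Rightarrow> real) \<Rightarrow> bool" where
  "weighted_l2_norm N \<longleftrightarrow> (\<exists>P. sym_pos_def P \<and> (\<forall>x. N x = sqrt (x \<bullet> (P *v x))))"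

definition C1_vector_field :: "('a::real_normed_vector \<Rightarrow> 'a) \<Rightarrow> bool" where
  "C1_vector_field f \<longleftrightarrow>
     (\<exists>f' :: 'a \<Rightarrow> 'a \<Rightarrow>\<^sub>L 'a.
        (\<forall>x. (f has_derivative blinfun_apply (f' x)) (at x)) \<and> continuous_on UNIV f')"

(* The flow is a function of time and initial point; only its values at times t >= 0 are
   constrained, and the derivative at t = 0 is one-sided. For a C^1 field f, solutions of the
   initial value problem are unique, so these values are determined by f. *)
definition forward_flow :: "('a::real_normed_vector \<Rightarrow> 'a) \<Rightarrow> (real \<Rightarrow> 'a \<Rightarrow> 'a) \<Rightarrow> bool" where
  "forward_flow f \<phi> \<longleftrightarrow>
     (\<forall>x. \<phi> 0 x = x \<and>
          (\<forall>t\<ge>0. ((\<lambda>s. \<phi> s x) has_vector_derivative f (\<phi> t x)) (at t within {0..})))"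

definition nonexpansive_flow :: "('a::real_vector \<Rightarrow> real) \<Rightarrow> (real \<Rightarrow> 'a \<Rightarrow> 'a) \<Rightarrow> bool" where
  "nonexpansive_flow N \<phi> \<longleftrightarrow> (\<forall>t>0. \<forall>x y. N (\<phi> t x - \<phi> t y) \<le> N (x - y))"

definition equilibria :: "('a \<Rightarrow> 'a::zero) \<Rightarrow> 'a set" where
  "equilibria f = {p. f p = 0}"

(* infdist x {} = 0 in the library, so nonemptiness of A has to be required explicitly.
   infdist is the Euclidean distance to A on real ^ 'n; since all norms there are equivalent,
   the property does not depend on this choice. *)
definition converges_to_set :: "(real \<Rightarrow> 'a::metric_space) \<Rightarrow> 'a set \<Rightarrow> bool" where
  "converges_to_set u A \<longleftrightarrow> A \<noteq> {} \<and> ((\<lambda>t. infdist (u t) A) \<longlongrightarrow> 0) at_top"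

end

theory Submission
  imports Defs
begin

text \<open>
  Suppose a bounded trajectory has an \<open>\<omega>\<close>-limit point \<open>z\<close> that is not an equilibrium. Such a
  point forces \<open>N\<close> to be a weighted Euclidean norm, for the following reason.

  A bounded trajectory yields, by Brouwer's theorem, an equilibrium \<open>p\<close>
  (\<open>equilibrium_exists\<close>). Nonexpansiveness makes \<open>z\<close> recurrent, so the nonincreasing
  quantity \<open>N (\<phi> t z - p)\<close> is constant: the orbit of \<open>z\<close> lives on an \<open>N\<close>-sphere around \<open>p\<close>,
  which is a closed curve. It cannot turn back on this curve, because a turning point would
  give points with arbitrarily small return times, that is, an equilibrium; and by
  recurrence it cannot stop short of a full turn. So the orbit is periodic and is the whole sphere
  (\<open>recurrent_orbit_fills_sphere\<close>).

  Let \<open>T\<close> be the period. The map \<open>\<phi> T\<close> fixes the sphere pointwise, hence by Brouwer's theorem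
  maps the ball that it bounds onto itself; a nonexpansive surjection of a compact space is
  an isometry, and therefore every \<open>\<phi> t\<close> with \<open>t \<le> T\<close> is an isometry of the ball onto itself. As
  in the Mazur-Ulam theorem, such an isometry preserves the midpoint of \<open>p\<close> and
  any point of the ball: this midpoint is determined by distances inside the ball alone, even
  if \<open>N\<close> is not strictly convex. Differentiating in time, \<open>f (p + y / 2) = f (p + y) / 2\<close> on the
  ball, and differentiability of \<open>f\<close> at \<open>p\<close> upgrades this to \<open>f (p + y) = A y\<close> with
  \<open>A\<close> the derivative at \<open>p\<close> (\<open>linear_inside_recurrent_sphere\<close>).

  So the orbit solves \<open>u' = A u\<close>. The quadratic form \<open>Q w = det (w, A w)\<close> satisfies
  \<open>Q(u)' = (trace A) Q(u)\<close>, and periodicity makes it constant on the orbit, that is, on the sphere. If this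
  constant vanished, all vectors would be eigenvectors of \<open>A\<close> and the orbit could not be periodic
  without being at rest. Hence \<open>N\<^sup>2\<close> is a multiple of \<open>Q\<close>
  (\<open>nonequilibrium_recurrence_imp_weighted_l2\<close>).
\<close>

section \<open>Functions of one real variable\<close>

text \<open>
  Only an upper bound on the right slope is available for the distance of two trajectories, since
  a norm need not be differentiable. Subtracting \<open>k * s\<close> makes the bound strict enough to argue at
  the last time at which the function is still at most its initial value.
\<close>

lemma nonincreasing_if_right_slope_nonpos:
  fixes g :: "real \<Rightarrow> real"
  assumes cont: "continuous_on {0..} g"
    and slope: "\<And>t e. 0 \<le> t \<Longrightarrow> 0 < e \<Longrightarrow> \<forall>\<^sub>F h in at_right 0. g (t + h) \<le> g t + e * h"
    and "0 \<le> b"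
  shows "g b \<le> g 0"
proof (rule field_le_epsilon)
  fix e :: real
  assume "0 < e"
  define k where "k = e / (b + 1)"
  have "0 < k" using \<open>0 < e\<close> \<open>0 \<le> b\<close> by (simp add: k_def)
  define G where "G s = g s - k * s" for s
  have contG: "continuous_on {0..b} G"
    unfolding G_def by (intro continuous_intros continuous_on_subset[OF cont]) auto
  have "G b \<le> G 0"
  proof (rule ccontr)
    assume neg: "\<not> G b \<le> G 0"
    let ?S = "{0..b} \<inter> G -` {..G 0}"
    have "compact ?S"
      using continuous_closed_preimage[OF contG, of "{..G 0}"]
      by (auto simp: compact_eq_bounded_closed intro: bounded_subset[of "{0..b}"])
    moreover have "0 \<in> ?S" using \<open>0 \<le> b\<close> by auto
    ultimately obtain s where s: "s \<in> ?S" "\<And>u. u \<in> ?S \<Longrightarrow> u \<le> s"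
      using compact_attains_sup[of ?S] by blast
    have "s < b" using s(1) neg by (cases "s = b") auto
    have "\<forall>\<^sub>F h in at_right 0. g (s + h) \<le> g s + k * h" using slope[of s k] s(1) \<open>0 < k\<close> by auto
    moreover have "\<forall>\<^sub>F h in at_right 0. h \<in> {0<..<b - s}"
      using \<open>s < b\<close> by (intro eventually_at_right_real) auto
    ultimately have "\<forall>\<^sub>F h in at_right (0::real). False"
    proof eventually_elim
      case (elim h)
      then have "G (s + h) \<le> G s" by (simp add: G_def algebra_simps)
      then have "s + h \<in> ?S" using elim s(1) by auto
      then show False using s(2)[of "s + h"] elim by auto
    qed
    then show False by (simp add: eventually_False)
  qed
  then have "g b \<le> g 0 + k * b" by (simp add: G_def)
  moreover have "k * b \<le> e" using \<open>0 < e\<close> \<open>0 \<le> b\<close> by (simp add: k_def field_simps)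
  ultimately show "g b \<le> g 0 + e" by simp
qed

lemma has_vector_derivative_right_quotient:
  assumes "(u has_vector_derivative v) (at t within {0..})" "0 \<le> t"
  shows "((\<lambda>h. (u (t + h) - u t) /\<^sub>R h) \<longlongrightarrow> v) (at_right 0)"
proof -
  have "(u has_vector_derivative v) (at t within {t<..})"
    using assms by (auto intro: has_vector_derivative_within_subset)
  then have "((\<lambda>y. (1 / norm (y - t)) *\<^sub>R (u y - (u t + (y - t) *\<^sub>R v))) \<longlongrightarrow> 0) (at_right t)"
    by (simp add: has_vector_derivative_def has_derivative_within)
  then have "((\<lambda>y. (u y - u t) /\<^sub>R (y - t) - v) \<longlongrightarrow> 0) (at_right t)"
  proof (rule Lim_transform_eventually)
    show "\<forall>\<^sub>F y in at_right t. (1 / norm (y - t)) *\<^sub>R (u y - (u t + (y - t) *\<^sub>R v)) = (u y - u t) /\<^sub>R (y - t) - v"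
      unfolding eventually_at_filter
    proof (intro always_eventually allI impI)
      fix y
      assume "y \<noteq> t" "y \<in> {t<..}"
      then have "(1 / norm (y - t)) *\<^sub>R (u y - (u t + (y - t) *\<^sub>R v))
          = inverse (y - t) *\<^sub>R ((u y - u t) - (y - t) *\<^sub>R v)"
        by (simp add: diff_diff_add divide_inverse)
      also have "\<dots> = (u y - u t) /\<^sub>R (y - t) - (inverse (y - t) * (y - t)) *\<^sub>R v"
        by (simp only: scaleR_diff_right scaleR_scaleR)
      finally show "(1 / norm (y - t)) *\<^sub>R (u y - (u t + (y - t) *\<^sub>R v)) = (u y - u t) /\<^sub>R (y - t) - v"
        using \<open>y \<noteq> t\<close> by simp
    qed
  qed
  then have "((\<lambda>y. (u y - u t) /\<^sub>R (y - t)) \<longlongrightarrow> v) (at_right t)"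
    by (simp flip: Lim_null)
  then show ?thesis
    by (simp add: filterlim_at_right_to_0[of _ _ t] add.commute)
qed

text \<open>
  A continuous function with equal endpoint values has horizontal chords of length
  \<open>(b - a) / 2 ^ n\<close> for every \<open>n\<close>: if \<open>g\<close> agrees at the ends of an interval of length \<open>2 * h\<close>, the
  increment \<open>g (s + h) - g s\<close> has opposite signs at \<open>s = c\<close> and \<open>s = c + h\<close>. For the angle along an
  orbit these chords are return times as small as desired.
\<close>

lemma equal_endpoints_imp_halving_chords:
  fixes g :: "real \<Rightarrow> real"
  assumes "a \<le> b" "continuous_on {a..b} g" "g a = g b"
  shows "\<exists>c\<in>{a..b - (b - a) / 2 ^ n}. g c = g (c + (b - a) / 2 ^ n)"
proof (induction n)
  case 0
  then show ?case using assms by auto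
next
  case (Suc n)
  define h where "h = (b - a) / 2 ^ Suc n"
  have h: "0 \<le> h" "(b - a) / 2 ^ n = 2 * h" using assms by (auto simp: h_def divide_simps)
  with Suc obtain c where c: "a \<le> c" "c + 2 * h \<le> b" "g c = g (c + 2 * h)" by auto
  define d where "d s = g (s + h) - g s" for s
  have "continuous_on {c..c + h} d"
    unfolding d_def using c h by (intro continuous_intros continuous_on_compose2[OF assms(2)]) auto
  then have conn: "connected (d ` {c..c + h})" by (intro connected_continuous_image) auto
  have "d (c + h) = - d c" using c(3) by (simp add: d_def algebra_simps)
  moreover have "d c \<in> d ` {c..c + h}" "d (c + h) \<in> d ` {c..c + h}" using h by auto
  ultimately have "0 \<in> d ` {c..c + h}"
    using conn unfolding connected_iff_interval by (metis linear neg_0_le_iff_le neg_le_0_iff_le)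
  then obtain s where "s \<in> {c..c + h}" "g s = g (s + h)" by (auto simp: d_def)
  then show ?case using c h unfolding h_def[symmetric] by (intro bexI[of _ s]) auto
qed

text \<open>
  Solutions of \<open>g' = k * g\<close> are exponentials, and an exponential that takes the same value twice
  is constant.
\<close>

lemma returning_linear_growth:
  fixes g :: "real \<Rightarrow> real"
  assumes deriv: "\<And>t. 0 \<le> t \<Longrightarrow> (g has_real_derivative k * g t) (at t within {0..})"
    and "0 < T" "g T = g 0"
  shows "k = 0 \<or> g 0 = 0" and "0 \<le> t \<Longrightarrow> g t = g 0"
proof -
  have "((\<lambda>s. g s * exp (- k * s)) has_real_derivative 0) (at t within {0..})" if "t \<in> {0..}" for t
    using that by (auto intro!: derivative_eq_intros deriv)
  then obtain c where c: "\<And>t. t \<in> {0..} \<Longrightarrow> g t * exp (- k * t) = c"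
    using has_field_derivative_zero_constant[of "{0..}"] by (metis (no_types, lifting) convex_real_interval(1))
  have growth: "g t = g 0 * exp (k * t)" if "0 \<le> t" for t
    using c[of t] c[of 0] that by (simp add: exp_minus field_simps)
  show alt: "k = 0 \<or> g 0 = 0" using growth[of T] \<open>0 < T\<close> \<open>g T = g 0\<close> by auto
  show "g t = g 0" if "0 \<le> t" using growth[OF that] alt by auto
qed

lemma binary_quadratic_form_has_derivative:
  fixes x y :: "real \<Rightarrow> real"
  assumes "(x has_real_derivative x') (at t within S)" "(y has_real_derivative y') (at t within S)"
  shows "((\<lambda>t. k * (x t)\<^sup>2 + l * (x t * y t) + m * (y t)\<^sup>2) has_real_derivative
    2 * k * x t * x' + l * (x' * y t + x t * y') + 2 * m * y t * y') (at t within S)"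
  by (auto intro!: derivative_eq_intros assms simp: algebra_simps)

section \<open>Norms and their isometries\<close>

locale norm_function =
  fixes N :: "'a::euclidean_space \<Rightarrow> real"
  assumes is_norm: "is_norm N"
begin

lemma N_nonneg [simp]: "0 \<le> N x"
  and N_eq_0 [simp]: "N x = 0 \<longleftrightarrow> x = 0"
  and N_scale [simp]: "N (c *\<^sub>R x) = \<bar>c\<bar> * N x"
  and N_triangle: "N (x + y) \<le> N x + N y"
  using is_norm by (auto simp: is_norm_def)

lemma N_zero [simp]: "N 0 = 0"
  by simp

lemma N_pos: "x \<noteq> 0 \<Longrightarrow> 0 < N x"
  using N_nonneg[of x] N_eq_0[of x] by linarith

lemma N_minus [simp]: "N (- x) = N x"
  using N_scale[of "-1" x] by (simp del: N_scale)

lemma N_minus_commute: "N (x - y) = N (y - x)"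
  using N_minus[of "x - y"] by simp

lemma N_diff_triangle: "N (x - z) \<le> N (x - y) + N (y - z)"
  using N_triangle[of "x - y" "y - z"] by simp

lemma continuous_on_N: "continuous_on UNIV N"
proof (rule convex_on_continuous)
  show "convex_on UNIV N"
    by (rule convex_onI) (auto intro: order_trans[OF N_triangle])
qed simp

lemma continuous_on_N_compose [continuous_intros]:
  "continuous_on S g \<Longrightarrow> continuous_on S (\<lambda>x. N (g x))"
  using continuous_on_compose2[OF continuous_on_N] by auto

lemma tendsto_N: "(g \<longlongrightarrow> l) F \<Longrightarrow> ((\<lambda>x. N (g x)) \<longlongrightarrow> N l) F"
  using continuous_on_N by (metis continuous_on_eq_continuous_at isCont_tendsto_compose open_UNIV UNIV_I)

lemma norm_le_N: obtains C where "0 < C" "\<And>x. norm x \<le> C * N x"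
proof -
  have "sphere (0::'a) 1 \<noteq> {}" by simp
  then obtain a :: 'a where a: "a \<in> sphere 0 1" "\<And>x. x \<in> sphere 0 1 \<Longrightarrow> N a \<le> N x"
    using continuous_attains_inf[OF compact_sphere _ continuous_on_subset[OF continuous_on_N]]
    by (metis subset_UNIV)
  have "0 < N a" using a(1) by (intro N_pos) auto
  moreover have "norm x \<le> (1 / N a) * N x" for x
  proof (cases "x = 0")
    case False
    then have "N a \<le> N ((1 / norm x) *\<^sub>R x)" by (intro a(2)) auto
    then show ?thesis using False \<open>0 < N a\<close> by (simp add: field_simps)
  qed simp
  ultimately show thesis using that[of "1 / N a"] by auto
qed

lemma bounded_if_N_le:
  assumes "\<And>x. x \<in> S \<Longrightarrow> N (x - p) \<le> r"
  shows "bounded S"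
proof -
  obtain C where C: "0 < C" "\<And>x. norm x \<le> C * N x" using norm_le_N by blast
  have "dist p x \<le> C * r" if "x \<in> S" for x
    using C(2)[of "x - p"] assms[OF that] C(1)
    by (metis dist_norm dist_commute mult_le_cancel_left_pos order_trans)
  then show ?thesis unfolding bounded_def by blast
qed

lemma dist_le_of_N_small:
  assumes "0 < e"
  obtains d where "0 < d" "\<And>x y. N (x - y) < d \<Longrightarrow> dist x y < e"
proof -
  obtain C where C: "0 < C" "\<And>x. norm x \<le> C * N x" using norm_le_N by blast
  have "dist x y < e" if "N (x - y) < e / C" for x y
    using that C(1) C(2)[of "x - y"] by (simp add: dist_norm field_simps)
  then show thesis using that[of "e / C"] assms C(1) by auto
qed

lemma compact_N_cball: "compact {q. N (q - p) \<le> r}"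
proof -
  have "closed {q. N (q - p) \<le> r}"
    by (intro closed_Collect_le continuous_intros)
  then show ?thesis using bounded_if_N_le[of "{q. N (q - p) \<le> r}"] 
    by (auto simp: compact_eq_bounded_closed)
qed

text \<open>
  Follow \<open>a\<close> and \<open>b\<close> backwards through preimages under \<open>g\<close>. Their distance cannot decrease along
  the way. By compactness the pair of backward orbits nearly returns to an earlier pair; pushing
  that return forward by \<open>g\<close>, which can only improve it, shows that the orbits nearly return
  to \<open>g a\<close> and \<open>g b\<close> themselves. So \<open>N (a - b)\<close> exceeds \<open>N (g a - g b)\<close> by at most \<open>e\<close>, for every positive \<open>e\<close>.
\<close>

lemma surjective_nonexpansive_isometry:
  assumes "compact B" "g ` B = B"
    and nonexp: "\<And>x y. x \<in> B \<Longrightarrow> y \<in> B \<Longrightarrow> N (g x - g y) \<le> N (x - y)"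
    and "a \<in> B" "b \<in> B"
  shows "N (g a - g b) = N (a - b)"
proof -
  define h where "h = inv_into B g"
  have h: "h y \<in> B" "g (h y) = y" if "y \<in> B" for y
    using that \<open>g ` B = B\<close> by (auto simp: h_def inv_into_into f_inv_into_f)
  \<comment> \<open>the backward orbit of \<open>g x\<close>, chosen to pass through \<open>x\<close> itself at the first step\<close>
  define pre where "pre x n = (case n of 0 \<Rightarrow> g x | Suc k \<Rightarrow> (h ^^ k) x)" for x n
  have pow: "(h ^^ k) x \<in> B" if "x \<in> B" for x k
    by (induction k) (use that h in auto)
  have pre_in: "pre x n \<in> B" if "x \<in> B" for x n
    using pow[OF that] that \<open>g ` B = B\<close> by (auto simp: pre_def split: nat.split)
  have g_pre: "g (pre x (Suc n)) = pre x n" if "x \<in> B" for x n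
    using h(2) pow[OF that] by (cases n) (auto simp: pre_def)
  have shift: "N (pre x i - pre y j) \<le> N (pre x (i + m) - pre y (j + m))"
    if "x \<in> B" "y \<in> B" for x y i j m
  proof (induction m)
    case (Suc m)
    have "N (pre x (i + m) - pre y (j + m)) \<le> N (pre x (Suc (i + m)) - pre y (Suc (j + m)))"
      using nonexp[of "pre x (Suc (i + m))" "pre y (Suc (j + m))"] g_pre pre_in that by simp
    then show ?case using Suc by simp
  qed simp
  have "N (a - b) \<le> N (g a - g b) + e" if "0 < e" for e
  proof -
    have "seq_compact (B \<times> B)" using \<open>compact B\<close> by (simp add: compact_Times compact_imp_seq_compact)
    then obtain l r where "l \<in> B \<times> B" and r: "strict_mono r"
        "((\<lambda>n. (pre a n, pre b n)) \<circ> r) \<longlonglongrightarrow> l"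
      using pre_in[OF assms(4)] pre_in[OF assms(5)]
      by (elim seq_compactE[where f = "\<lambda>n. (pre a n, pre b n)"]) auto
    then have "(\<lambda>i. pre a (r i)) \<longlonglongrightarrow> fst l" "(\<lambda>i. pre b (r i)) \<longlonglongrightarrow> snd l"
      using tendsto_fst[OF r(2)] tendsto_snd[OF r(2)] by (simp_all add: o_def)
    then have lim: "(\<lambda>i. N (pre a (r i) - fst l)) \<longlonglongrightarrow> N 0" "(\<lambda>i. N (pre b (r i) - snd l)) \<longlonglongrightarrow> N 0"
      by (auto intro!: tendsto_N simp: Lim_null[symmetric] simp del: N_zero)
    have "\<forall>\<^sub>F i in sequentially. N (pre a (r i) - fst l) < e / 4 \<and> N (pre b (r i) - snd l) < e / 4"
      using order_tendstoD(2)[OF lim(1), of "e / 4"] order_tendstoD(2)[OF lim(2), of "e / 4"] \<open>0 < e\<close>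
      by (auto intro: eventually_conj)
    then obtain i where i: "\<And>j. i \<le> j \<Longrightarrow> N (pre a (r j) - fst l) < e / 4 \<and> N (pre b (r j) - snd l) < e / 4"
      unfolding eventually_sequentially by blast
    define m k where "m = r i" and "k = r (Suc i) - r i"
    have k: "r (Suc i) = k + m" "1 \<le> k"
      using strict_monoD[OF r(1), of i "Suc i"] by (auto simp: m_def k_def)
    have ret: "N (pre x k - pre x 0) < e / 2" if "x \<in> B" "N (pre x (r i) - q) < e / 4" "N (pre x (r (Suc i)) - q) < e / 4" for x q
    proof -
      have "N (pre x k - pre x 0) \<le> N (pre x (k + m) - pre x (0 + m))"
        using shift[OF that(1) that(1)] .
      also have "\<dots> \<le> N (pre x (k + m) - q) + N (q - pre x m)"
        using N_diff_triangle[of _ _ q] by simp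
      also have "\<dots> < e / 2" using that k N_minus_commute[of q "pre x m"] by (simp add: m_def)
      finally show ?thesis .
    qed
    have "N (a - b) = N (pre a 1 - pre b 1)" by (simp add: pre_def)
    also have "\<dots> \<le> N (pre a (1 + (k - 1)) - pre b (1 + (k - 1)))" using shift[OF assms(4,5)] .
    also have "\<dots> = N (pre a k - pre b k)" using k by simp
    also have "\<dots> \<le> N (pre a k - pre a 0) + (N (pre a 0 - pre b 0) + N (pre b 0 - pre b k))"
      by (meson N_diff_triangle add_left_mono order_trans)
    also have "\<dots> \<le> N (pre a 0 - pre b 0) + e"
      using ret[OF assms(4), of "fst l"] ret[OF assms(5), of "snd l"] i[of i] i[of "Suc i"]
        N_minus_commute[of "pre b 0" "pre b k"] by simp
    finally show ?thesis by (simp add: pre_def)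
  qed
  then have "N (a - b) \<le> N (g a - g b)" by (rule field_le_epsilon)
  then show ?thesis using nonexp[OF assms(4,5)] by simp
qed

text \<open>
  Extended by the identity outside the ball, \<open>g\<close> is a bounded perturbation of the identity of the whole
  space and hence surjective by Brouwer's theorem; points outside the ball only hit themselves.
\<close>

lemma sphere_fixing_map_surjective:
  assumes cont: "continuous_on {q. N (q - p) \<le> r} g"
    and fix_sphere: "\<And>q. N (q - p) = r \<Longrightarrow> g q = q"
    and "N (q - p) \<le> r"
  obtains y where "N (y - p) \<le> r" "g y = q"
proof -
  define G where "G y = (if N (y - p) \<le> r then g y else y)" for y
  have cont_G: "continuous_on UNIV G"
    unfolding G_def using cont fix_sphere
    by (intro continuous_on_cases_le) (auto intro!: continuous_intros)
  have "bounded ((\<lambda>y. y - g y) ` {q. N (q - p) \<le> r})"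
    by (intro compact_imp_bounded compact_continuous_image compact_N_cball continuous_intros cont)
  then obtain M where M: "0 < M" "\<And>y. N (y - p) \<le> r \<Longrightarrow> norm (y - g y) \<le> M"
    unfolding bounded_pos by auto
  have "\<exists>y\<in>cball q M. G y = q"
  proof (rule brouwer_surjective[where S = "{q}"])
    fix x y
    assume "x \<in> {q}"
    then show "x + (y - G y) \<in> cball q M"
      using M(1) M(2)[of y] by (auto simp: G_def dist_norm norm_minus_commute)
  qed (use M(1) in \<open>auto intro: continuous_on_subset[OF cont_G]\<close>)
  then obtain y where "G y = q" by blast
  then show thesis using that \<open>N (q - p) \<le> r\<close> by (auto simp: G_def split: if_splits)
qed

text \<open>
  The sets that shrink to the midpoint of \<open>a\<close> and \<open>b\<close> in the proof of the Mazur-Ulam theorem,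
  described by distances only. When \<open>N\<close> is not strictly convex, the set of metric midpoints
  \<open>center 0 a b\<close> can be large. The usual recursion asks for half of the diameter of the preceding
  set; the explicit bounds \<open>N (a - b) / 2 ^ n\<close> serve the same purpose.
\<close>

primrec center :: "nat \<Rightarrow> 'a \<Rightarrow> 'a \<Rightarrow> 'a set" where
  "center 0 a b = {x. N (x - a) = N (a - b) / 2 \<and> N (x - b) = N (a - b) / 2}"
| "center (Suc n) a b = {x \<in> center n a b. \<forall>y\<in>center n a b. N (x - y) \<le> N (a - b) / 2 ^ Suc n}"

lemma center_subset: "center n a b \<subseteq> center 0 a b"
  by (induction n) auto

lemma center_diameter: "x \<in> center n a b \<Longrightarrow> y \<in> center n a b \<Longrightarrow> N (x - y) \<le> N (a - b) / 2 ^ n"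
proof (cases n)
  case 0
  assume "x \<in> center n a b" "y \<in> center n a b"
  then show ?thesis using 0 N_diff_triangle[of x y a] N_minus_commute[of a y] by simp
qed auto

text \<open>
  The centers are symmetric under the reflection \<open>a + b - x\<close> in the midpoint. This is what keeps the
  midpoint in all of them, since a point and its reflection are twice as far apart as the
  point and the midpoint.
\<close>

lemma center_symmetric: "x \<in> center n a b \<Longrightarrow> a + b - x \<in> center n a b"
proof (induction n arbitrary: x)
  case 0
  have "N (a + b - x - a) = N (x - b)" "N (a + b - x - b) = N (x - a)"
    using N_minus_commute[of b x] N_minus_commute[of a x] by (simp_all add: algebra_simps)
  then show ?case using 0 by simp
next
  case (Suc n)
  have "N (a + b - x - y) \<le> N (a - b) / 2 ^ Suc n" if "y \<in> center n a b" for y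
  proof -
    have "N (a + b - x - y) = N (x - (a + b - y))"
      using N_minus_commute[of "a + b - y" x] by (simp add: algebra_simps)
    then show ?thesis using Suc.prems Suc.IH[OF that] by simp
  qed
  then show ?case using Suc by simp
qed

lemma midpoint_in_center: "midpoint a b \<in> center n a b"
proof (induction n)
  case 0
  have "midpoint a b - a = (1/2) *\<^sub>R (b - a)" "midpoint a b - b = (1/2) *\<^sub>R (a - b)"
    by (simp_all add: midpoint_def algebra_simps flip: scaleR_add_left scaleR_half_double)
  then show ?case using N_minus_commute[of a b] by simp
next
  case (Suc n)
  have "N (midpoint a b - y) \<le> N (a - b) / 2 ^ Suc n" if "y \<in> center n a b" for y
  proof -
    have "a + b = 2 *\<^sub>R midpoint a b" by (simp add: midpoint_def)
    then have "(a + b - y) - y = 2 *\<^sub>R (midpoint a b - y)" by (simp add: algebra_simps scaleR_2)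
    then show ?thesis using center_diameter[OF center_symmetric[OF that] that] by simp
  qed
  then show ?case using Suc by simp
qed

lemma isometry_center_iff:
  assumes surj: "g ` B = B" and iso: "\<And>x y. x \<in> B \<Longrightarrow> y \<in> B \<Longrightarrow> N (g x - g y) = N (x - y)"
    and "a \<in> B" "b \<in> B" and sub: "center 0 a b \<subseteq> B" "center 0 (g a) (g b) \<subseteq> B"
    and "x \<in> B"
  shows "g x \<in> center n (g a) (g b) \<longleftrightarrow> x \<in> center n a b"
  using \<open>x \<in> B\<close>
proof (induction n arbitrary: x)
  case 0
  then show ?case using iso assms by simp
next
  case (Suc n)
  have "(\<forall>y\<in>center n (g a) (g b). N (g x - y) \<le> N (a - b) / 2 ^ Suc n)
      \<longleftrightarrow> (\<forall>y\<in>center n a b. N (x - y) \<le> N (a - b) / 2 ^ Suc n)" (is "?L \<longleftrightarrow> ?R")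
  proof
    assume ?L
    then show ?R using Suc center_subset[of n a b] sub(1) iso[OF Suc.prems] by (metis subsetD)
  next
    assume ?R
    show ?L
    proof
      fix y
      assume y: "y \<in> center n (g a) (g b)"
      then obtain w where "w \<in> B" "y = g w" using center_subset[of n "g a" "g b"] sub(2) surj by blast
      then show "N (g x - y) \<le> N (a - b) / 2 ^ Suc n" using Suc \<open>?R\<close> y iso by simp
    qed
  qed
  then show ?case using Suc iso assms by simp
qed

text \<open>
  The isometry is given on \<open>B\<close> only, so the metric midpoints of \<open>a\<close> and \<open>b\<close> and of their images have to
  lie in \<open>B\<close>. Then \<open>g\<close> carries centers to centers, and their diameters tend to zero.
\<close>

lemma isometry_preserves_midpoint:
  assumes surj: "g ` B = B" and iso: "\<And>x y. x \<in> B \<Longrightarrow> y \<in> B \<Longrightarrow> N (g x - g y) = N (x - y)"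
    and "a \<in> B" "b \<in> B" and sub: "center 0 a b \<subseteq> B" "center 0 (g a) (g b) \<subseteq> B"
  shows "g (midpoint a b) = midpoint (g a) (g b)"
proof -
  have "N (g (midpoint a b) - midpoint (g a) (g b)) \<le> N (g a - g b) / 2 ^ n" for n
  proof (rule center_diameter[OF _ midpoint_in_center])
    show "g (midpoint a b) \<in> center n (g a) (g b)"
      using isometry_center_iff[OF assms] midpoint_in_center center_subset[of n a b] sub(1) by blast
  qed
  moreover have "(\<lambda>n. N (g a - g b) / 2 ^ n) \<longlonglongrightarrow> 0"
    by (rule LIMSEQ_divide_realpow_zero) simp
  ultimately have "N (g (midpoint a b) - midpoint (g a) (g b)) \<le> 0"
    by (intro LIMSEQ_le_const) auto
  then show ?thesis using N_pos[of "g (midpoint a b) - midpoint (g a) (g b)"] by force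
qed

text \<open>
  Every metric midpoint of \<open>p\<close> and a point of a ball around \<open>p\<close> has at most half the radius as its
  distance from \<open>p\<close>, so it stays in the ball. For two arbitrary points of the ball this can fail.
\<close>

lemma ball_isometry_preserves_midpoint:
  assumes "g ` {q. N (q - p) \<le> r} = {q. N (q - p) \<le> r}"
    and iso: "\<And>x y. N (x - p) \<le> r \<Longrightarrow> N (y - p) \<le> r \<Longrightarrow> N (g x - g y) = N (x - y)"
    and "g p = p" "N (a - p) \<le> r"
  shows "g (midpoint a p) = midpoint (g a) p"
proof -
  have "center 0 q p \<subseteq> {q. N (q - p) \<le> r}" if "N (q - p) \<le> r" for q
    using that N_nonneg[of "q - p"] by (auto simp del: N_nonneg)
  moreover have "N (g a - p) \<le> r"
    using assms(1,4) by blast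
  moreover have "0 \<le> r" using N_nonneg[of "a - p"] assms(4) by linarith
  ultimately show ?thesis
    using isometry_preserves_midpoint[of g "{q. N (q - p) \<le> r}" a p] assms by simp
qed

end

section \<open>Nonexpansive semiflows\<close>

locale nonexpansive_semiflow = norm_function N
  for N :: "'a::euclidean_space \<Rightarrow> real" +
  fixes f :: "'a \<Rightarrow> 'a" and \<phi> :: "real \<Rightarrow> 'a \<Rightarrow> 'a"
  assumes forward_flow: "forward_flow f \<phi>"
    and nonexpansive_flow: "nonexpansive_flow N \<phi>"
begin

lemma flow_0 [simp]: "\<phi> 0 y = y"
  and flow_deriv: "0 \<le> t \<Longrightarrow> ((\<lambda>s. \<phi> s y) has_vector_derivative f (\<phi> t y)) (at t within {0..})"
  using forward_flow by (auto simp: forward_flow_def)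

lemma nonexpansive: "0 \<le> t \<Longrightarrow> N (\<phi> t y - \<phi> t w) \<le> N (y - w)"
  using nonexpansive_flow by (cases "t = 0") (auto simp: nonexpansive_flow_def)

lemma continuous_on_flow_time: "continuous_on {0..} (\<lambda>t. \<phi> t y)"
  unfolding continuous_on_eq_continuous_within
  using has_vector_derivative_continuous[OF flow_deriv] by auto

lemma continuous_on_flow: "0 \<le> t \<Longrightarrow> continuous_on S (\<phi> t)"
  unfolding continuous_on_iff
proof (intro ballI allI impI)
  fix y :: "'a" and e :: real
  assume "0 \<le> t" "0 < e"
  obtain d where d: "0 < d" "\<And>x y. N (x - y) < d \<Longrightarrow> dist x y < e"
    using dist_le_of_N_small[OF \<open>0 < e\<close>] by blast
  have "isCont N 0"
    using continuous_on_N by (simp add: continuous_on_eq_continuous_at)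
  then obtain b where b: "0 < b" "\<And>x. dist x 0 < b \<Longrightarrow> dist (N x) (N 0) < d"
    using \<open>0 < d\<close> unfolding continuous_at_eps_delta by blast
  have "dist (\<phi> t w) (\<phi> t y) < e" if "dist w y < b" for w
  proof (rule d(2))
    have "N (w - y) < d" using b(2)[of "w - y"] that by (simp add: dist_norm)
    then show "N (\<phi> t w - \<phi> t y) < d" using nonexpansive[OF \<open>0 \<le> t\<close>, of w y] by simp
  qed
  then show "\<exists>d>0. \<forall>x'\<in>S. dist x' y < d \<longrightarrow> dist (\<phi> t x') (\<phi> t y) < e" using \<open>0 < b\<close> by blast
qed

text \<open>
  Over a short time \<open>h\<close> a solution differs from the flow started at its current value by \<open>o(h)\<close>, as both
  have the same derivative. Nonexpansiveness of the flow therefore bounds the right slope of the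
  distance of two solutions by zero. Uniqueness of solutions and the semigroup law
  of \<open>\<phi>\<close> follow from this.
\<close>

lemma solutions_nonexpansive:
  assumes u: "\<And>t. 0 \<le> t \<Longrightarrow> (u has_vector_derivative f (u t)) (at t within {0..})"
    and w: "\<And>t. 0 \<le> t \<Longrightarrow> (w has_vector_derivative f (w t)) (at t within {0..})"
    and "0 \<le> t"
  shows "N (u t - w t) \<le> N (u 0 - w 0)"
proof (rule nonincreasing_if_right_slope_nonpos[OF _ _ \<open>0 \<le> t\<close>])
  show "continuous_on {0..} (\<lambda>t. N (u t - w t))"
    using has_vector_derivative_continuous[OF u] has_vector_derivative_continuous[OF w]
    by (intro continuous_intros) (auto simp: continuous_on_eq_continuous_within)
  have local_flow: "\<forall>\<^sub>F h in at_right 0. N (v (s + h) - \<phi> h (v s)) \<le> e * h"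
    if v: "\<And>t. 0 \<le> t \<Longrightarrow> (v has_vector_derivative f (v t)) (at t within {0..})"
      and "0 \<le> s" "0 < e" for v s e
  proof -
    have "((\<lambda>h. (v (s + h) - v s) /\<^sub>R h) \<longlongrightarrow> f (v s)) (at_right 0)"
      using has_vector_derivative_right_quotient[OF v[OF \<open>0 \<le> s\<close>] \<open>0 \<le> s\<close>] .
    moreover have "((\<lambda>h. (\<phi> h (v s) - v s) /\<^sub>R h) \<longlongrightarrow> f (v s)) (at_right 0)"
      using has_vector_derivative_right_quotient[OF flow_deriv[of 0 "v s"]] by simp
    ultimately have "((\<lambda>h. N ((v (s + h) - v s) /\<^sub>R h - (\<phi> h (v s) - v s) /\<^sub>R h)) \<longlongrightarrow> N (f (v s) - f (v s))) (at_right 0)"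
      by (intro tendsto_N tendsto_diff)
    then have "\<forall>\<^sub>F h in at_right 0. N ((v (s + h) - v s) /\<^sub>R h - (\<phi> h (v s) - v s) /\<^sub>R h) < e"
      using \<open>0 < e\<close> by (intro order_tendstoD(2)) auto
    moreover have "\<forall>\<^sub>F h :: real in at_right 0. 0 < h" by (simp add: eventually_at_right_less)
    ultimately show ?thesis
    proof eventually_elim
      case (elim h)
      have "(v (s + h) - v s) /\<^sub>R h - (\<phi> h (v s) - v s) /\<^sub>R h = inverse h *\<^sub>R (v (s + h) - \<phi> h (v s))"
        by (simp add: algebra_simps)
      with elim(1) have "N (inverse h *\<^sub>R (v (s + h) - \<phi> h (v s))) < e" by (simp only:)
      then have "inverse h * N (v (s + h) - \<phi> h (v s)) < e" using elim(2) by simp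
      then show ?case using elim(2) by (simp add: field_simps)
    qed
  qed
  fix s e :: real
  assume "0 \<le> s" "0 < e"
  have "\<forall>\<^sub>F h in at_right 0. N (u (s + h) - \<phi> h (u s)) \<le> e / 2 * h"
    by (rule local_flow) (use u \<open>0 \<le> s\<close> \<open>0 < e\<close> in auto)
  moreover have "\<forall>\<^sub>F h in at_right 0. N (w (s + h) - \<phi> h (w s)) \<le> e / 2 * h"
    by (rule local_flow) (use w \<open>0 \<le> s\<close> \<open>0 < e\<close> in auto)
  moreover have "\<forall>\<^sub>F h :: real in at_right 0. 0 < h" by (simp add: eventually_at_right_less)
  ultimately show "\<forall>\<^sub>F h in at_right 0. N (u (s + h) - w (s + h)) \<le> N (u s - w s) + e * h"
  proof eventually_elim
    case (elim h)
    have "N (u (s + h) - w (s + h)) \<le> N (u (s + h) - \<phi> h (u s)) + (N (\<phi> h (u s) - \<phi> h (w s)) + N (\<phi> h (w s) - w (s + h)))"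
      by (meson N_diff_triangle add_left_mono order_trans)
    also have "\<dots> \<le> e / 2 * h + (N (u s - w s) + e / 2 * h)"
      using elim nonexpansive[of h "u s" "w s"] N_minus_commute[of "\<phi> h (w s)" "w (s + h)"] by simp
    finally show ?case by simp
  qed
qed

lemma flow_unique:
  assumes "\<And>t. 0 \<le> t \<Longrightarrow> (u has_vector_derivative f (u t)) (at t within {0..})" "0 \<le> t"
  shows "u t = \<phi> t (u 0)"
proof -
  have "N (u t - \<phi> t (u 0)) \<le> N (u 0 - \<phi> 0 (u 0))"
    by (rule solutions_nonexpansive) (use assms flow_deriv in auto)
  then show ?thesis using N_pos[of "u t - \<phi> t (u 0)"] by force
qed

lemma flow_add:
  assumes "0 \<le> s" "0 \<le> t"
  shows "\<phi> (s + t) y = \<phi> t (\<phi> s y)"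
proof -
  have "((\<lambda>r. \<phi> (s + r) y) has_vector_derivative f (\<phi> (s + r) y)) (at r within {0..})" if "0 \<le> r" for r
  proof -
    have "((\<lambda>r. s + r) has_vector_derivative 1) (at r within {0..})"
      by (auto intro!: derivative_eq_intros)
    moreover have "((\<lambda>r. \<phi> r y) has_vector_derivative f (\<phi> (s + r) y)) (at (s + r) within (\<lambda>r. s + r) ` {0..})"
      by (rule has_vector_derivative_within_subset[OF flow_deriv]) (use \<open>0 \<le> s\<close> \<open>0 \<le> r\<close> in auto)
    ultimately show ?thesis using vector_diff_chain_within[of "\<lambda>r. s + r" 1 r "{0..}" "\<lambda>r. \<phi> r y"] by (simp add: o_def)
  qed
  from flow_unique[OF this \<open>0 \<le> t\<close>] show ?thesis by simp
qed

lemma flow_equilibrium: "f p = 0 \<Longrightarrow> 0 \<le> t \<Longrightarrow> \<phi> t p = p"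
  using flow_unique[of "\<lambda>_. p" t] by simp

lemma flow_fixed_multiple:
  assumes "\<phi> h q = q" "0 \<le> h"
  shows "\<phi> (real k * h) q = q"
proof (induction k)
  case (Suc k)
  then show ?case using flow_add[of "real k * h" h q] assms by (simp add: algebra_simps)
qed simp

text \<open>
  The time derivative of the flow at \<open>q\<close> can be computed along any sequence of times tending to
  zero, in particular along return times.
\<close>

lemma equilibrium_if_small_returns:
  assumes "0 < L" "\<And>n::nat. \<phi> (L / 2 ^ n) q = q"
  shows "f q = 0"
proof -
  have "((\<lambda>h. (\<phi> h q - q) /\<^sub>R h) \<longlongrightarrow> f q) (at_right 0)"
    using has_vector_derivative_right_quotient[OF flow_deriv[of 0 q]] by simp
  moreover have "filterlim (\<lambda>n::nat. L / 2 ^ n) (at_right 0) sequentially"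
    using LIMSEQ_divide_realpow_zero[of 2 L] \<open>0 < L\<close>
    by (intro tendsto_imp_filterlim_at_right) auto
  ultimately have "(\<lambda>n. (\<phi> (L / 2 ^ n) q - q) /\<^sub>R (L / 2 ^ n)) \<longlonglongrightarrow> f q"
    by (rule filterlim_compose)
  then have "(\<lambda>n::nat. 0) \<longlonglongrightarrow> f q" by (simp add: assms)
  then show ?thesis using LIMSEQ_unique tendsto_const by blast
qed

text \<open>
  The points \<open>y\<close> with \<open>N (\<phi> s x - y) \<le> M\<close> for all large \<open>s\<close> form a bounded convex set that the
  flow maps into itself. Brouwer's theorem gives a fixed point of \<open>\<phi> (1 / 2 ^ n)\<close> in its closure for each \<open>n\<close>.
  Fixed points at one dyadic time are fixed at all coarser ones, so a nested intersection of compact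
  sets gives a point with arbitrarily small return times.
\<close>

lemma equilibrium_exists:
  assumes "bounded {\<phi> t x | t. t \<ge> 0}"
  obtains p where "f p = 0"
proof -
  let ?O = "{\<phi> t x | t. t \<ge> 0}"
  have "bounded (N ` closure ?O)"
    using assms
    by (intro compact_imp_bounded compact_continuous_image continuous_on_subset[OF continuous_on_N]) auto
  then obtain M where "\<And>y. y \<in> closure ?O \<Longrightarrow> \<bar>N y\<bar> \<le> M"
    by (auto simp: bounded_iff)
  then have M: "N (\<phi> t x) \<le> M" if "0 \<le> t" for t
    using closure_subset[of ?O] that by (smt (verit) mem_Collect_eq subsetD)
  define K where "K = {y. \<exists>s0\<ge>0. \<forall>s\<ge>s0. N (\<phi> s x - y) \<le> M}"
  have "0 \<in> K" using M by (auto simp: K_def)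
  have "convex K"
  proof (rule convexI)
    fix y w and a b :: real
    assume "y \<in> K" "w \<in> K" and ab: "0 \<le> a" "0 \<le> b" "a + b = 1"
    then obtain s1 s2 where s: "0 \<le> s1" "\<And>s. s1 \<le> s \<Longrightarrow> N (\<phi> s x - y) \<le> M"
        "0 \<le> s2" "\<And>s. s2 \<le> s \<Longrightarrow> N (\<phi> s x - w) \<le> M" by (auto simp: K_def)
    have "N (\<phi> s x - (a *\<^sub>R y + b *\<^sub>R w)) \<le> M" if "max s1 s2 \<le> s" for s
    proof -
      have "\<phi> s x = (a + b) *\<^sub>R \<phi> s x" using ab by simp
      then have "\<phi> s x - (a *\<^sub>R y + b *\<^sub>R w) = a *\<^sub>R (\<phi> s x - y) + b *\<^sub>R (\<phi> s x - w)"
        by (simp only: algebra_simps)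
      then have "N (\<phi> s x - (a *\<^sub>R y + b *\<^sub>R w)) \<le> a * N (\<phi> s x - y) + b * N (\<phi> s x - w)"
        using N_triangle[of "a *\<^sub>R (\<phi> s x - y)" "b *\<^sub>R (\<phi> s x - w)"] ab by simp
      also have "\<dots> \<le> a * M + b * M" using s that ab by (intro add_mono mult_left_mono) auto
      finally show ?thesis using ab by (simp flip: distrib_right)
    qed
    then show "a *\<^sub>R y + b *\<^sub>R w \<in> K" using s(1) unfolding K_def by (auto intro!: exI[of _ "max s1 s2"])
  qed
  have "bounded K"
  proof (rule bounded_if_N_le)
    fix y
    assume "y \<in> K"
    then obtain s where "0 \<le> s" "N (\<phi> s x - y) \<le> M" by (auto simp: K_def)
    then show "N (y - 0) \<le> 2 * M"
      using N_diff_triangle[of y 0 "\<phi> s x"] M[of s] N_minus_commute[of y "\<phi> s x"] by simp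
  qed
  have K_invariant: "\<phi> t y \<in> K" if "y \<in> K" "0 \<le> t" for y t
  proof -
    obtain s0 where s0: "0 \<le> s0" "\<And>s. s0 \<le> s \<Longrightarrow> N (\<phi> s x - y) \<le> M" using \<open>y \<in> K\<close> unfolding K_def by blast
    have "N (\<phi> s x - \<phi> t y) \<le> M" if "s0 + t \<le> s" for s
    proof -
      have "\<phi> s x = \<phi> t (\<phi> (s - t) x)" using flow_add[of "s - t" t x] that s0 \<open>0 \<le> t\<close> by simp
      then show ?thesis using nonexpansive[OF \<open>0 \<le> t\<close>, of "\<phi> (s - t) x" y] s0(2)[of "s - t"] that by simp
    qed
    then show ?thesis using s0(1) \<open>0 \<le> t\<close> unfolding K_def by (auto intro!: exI[of _ "s0 + t"])
  qed
  define F where "F n = {q \<in> closure K. \<phi> (1 / 2 ^ n) q = q}" for n :: nat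
  have "\<Inter> (range F) \<noteq> {}"
  proof (rule compact_nest)
    fix n :: nat
    have "closed (F n)"
      unfolding F_def Collect_conj_eq using continuous_on_flow[of "1 / 2 ^ n" UNIV]
      by (intro closed_Int closed_Collect_eq) (auto intro: continuous_on_id)
    then show "compact (F n)"
      using \<open>bounded K\<close> by (auto simp: compact_eq_bounded_closed F_def intro: bounded_subset[OF bounded_closure])
    have "\<phi> (1 / 2 ^ n) ` closure K \<subseteq> closure K"
      using K_invariant[of _ "1 / 2 ^ n"]
      by (intro image_closure_subset continuous_on_flow) (auto intro: closure_subset[THEN subsetD])
    then obtain q where "q \<in> closure K" "\<phi> (1 / 2 ^ n) q = q"
      using \<open>bounded K\<close> \<open>convex K\<close> \<open>0 \<in> K\<close>
      by (elim brouwer[rotated -1]) (auto intro: continuous_on_flow convex_closure)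
    then show "F n \<noteq> {}" by (auto simp: F_def)
  next
    fix m n :: nat
    assume "m \<le> n"
    then have "(2::real) ^ n = 2 ^ (n - m) * 2 ^ m" by (simp flip: power_add)
    then have "real (2 ^ (n - m)) * (1 / 2 ^ n) = 1 / 2 ^ m" by simp
    then show "F n \<subseteq> F m" using flow_fixed_multiple[of "1 / 2 ^ n" _ "2 ^ (n - m)"] by (auto simp: F_def)
  qed
  then obtain p where "\<And>n. \<phi> (1 / 2 ^ n) p = p" by (auto simp: F_def)
  then show thesis using that equilibrium_if_small_returns[of 1 p] by simp
qed

text \<open>
  In particular, \<open>omega_limit_point z z\<close> says that \<open>z\<close> is recurrent. Since \<open>N\<close> is equivalent
  to the given norm of the space, this is the usual notion.
\<close>

definition omega_limit_point :: "'a \<Rightarrow> 'a \<Rightarrow> bool" where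
  "omega_limit_point x z \<longleftrightarrow> (\<forall>e>0. \<forall>t0. \<exists>t\<ge>t0. 0 \<le> t \<and> N (\<phi> t x - z) < e)"

lemma omega_limit_pointE:
  assumes "omega_limit_point x z" "0 < e"
  obtains t where "t0 \<le> t" "0 \<le> t" "N (\<phi> t x - z) < e"
  using assms unfolding omega_limit_point_def by blast

text \<open>
  Between two late visits of the orbit of \<open>x\<close> near \<open>z\<close>, the orbit of \<open>z\<close> shadows that of \<open>x\<close> because
  distances do not grow; so it returns to \<open>z\<close> as well.
\<close>

lemma omega_limit_point_recurrent:
  assumes "omega_limit_point x z"
  shows "omega_limit_point z z"
  unfolding omega_limit_point_def
proof (intro allI impI)
  fix e t0 :: real
  assume "0 < e"
  obtain t1 where t1: "0 \<le> t1" "N (\<phi> t1 x - z) < e / 2"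
    using omega_limit_pointE[OF assms, of "e / 2" 0] \<open>0 < e\<close> by auto
  obtain t2 where t2: "t1 + max t0 0 \<le> t2" "N (\<phi> t2 x - z) < e / 2"
    using omega_limit_pointE[OF assms, of "e / 2"] \<open>0 < e\<close> by (metis half_gt_zero)
  have "t1 \<le> t2" using t2 by simp
  have "\<phi> t2 x = \<phi> (t2 - t1) (\<phi> t1 x)" using flow_add[of t1 "t2 - t1" x] t1 t2 by simp
  then have "N (\<phi> (t2 - t1) z - z) < e"
    using N_diff_triangle[of "\<phi> (t2 - t1) z" z "\<phi> t2 x"] nonexpansive[of "t2 - t1" z "\<phi> t1 x"]
      \<open>t1 \<le> t2\<close> t1 t2 N_minus_commute[of z "\<phi> t1 x"] by auto
  then show "\<exists>t\<ge>t0. 0 \<le> t \<and> N (\<phi> t z - z) < e" using t2 by (intro exI[of _ "t2 - t1"]) auto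
qed

text \<open>
  The distance to an equilibrium never increases, and recurrence forbids it to decrease.
\<close>

lemma recurrent_orbit_on_sphere:
  assumes "omega_limit_point z z" "f p = 0" "0 \<le> t"
  shows "N (\<phi> t z - p) = N (z - p)"
proof (rule antisym)
  show "N (\<phi> t z - p) \<le> N (z - p)"
    using nonexpansive[OF \<open>0 \<le> t\<close>, of z p] flow_equilibrium assms by simp
  show "N (z - p) \<le> N (\<phi> t z - p)"
  proof (rule field_le_epsilon)
    fix e :: real
    assume "0 < e"
    then obtain s where s: "t \<le> s" "N (\<phi> s z - z) < e" using omega_limit_pointE[OF assms(1), of e t] by blast
    have "N (\<phi> s z - p) \<le> N (\<phi> t z - p)"
      using flow_add[of t "s - t" z] nonexpansive[of "s - t" "\<phi> t z" p] flow_equilibrium[of p "s - t"] s assms by simp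
    then show "N (z - p) \<le> N (\<phi> t z - p) + e"
      using N_diff_triangle[of z p "\<phi> s z"] N_minus_commute[of z "\<phi> s z"] s by simp
  qed
qed

text \<open>
  An orbit that meets an equilibrium rests there from then on, so it can only return to \<open>z\<close> if
  \<open>z\<close> is that equilibrium.
\<close>

lemma recurrent_orbit_avoids_equilibria:
  assumes "omega_limit_point z z" "0 \<le> t" "f (\<phi> t z) = 0"
  shows "f z = 0"
proof -
  have "N (\<phi> t z - z) \<le> 0 + e" if e: "0 < e" for e
  proof -
    obtain s where s: "t \<le> s" "N (\<phi> s z - z) < e"
      using omega_limit_pointE[OF assms(1) e, of t] by blast
    then show ?thesis using flow_add[of t "s - t" z] flow_equilibrium[OF assms(3), of "s - t"] assms(2) by simp
  qed
  then have "N (\<phi> t z - z) \<le> 0" by (rule field_le_epsilon)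
  then have "\<phi> t z = z" using N_pos[of "\<phi> t z - z"] by fastforce
  then show ?thesis using assms(3) by simp
qed

end

section \<open>Recurrent orbits on a closed curve\<close>

text \<open>
  In the application, \<open>\<psi>\<close> parametrizes a closed curve by an angle. If the angle \<open>\<theta>\<close> never completed a turn, then from time \<open>2\<close> on
  \<open>\<psi> (\<theta> s)\<close> would stay in the compact arc from \<open>\<theta> 2\<close> to \<open>\<theta> 0 + 2 * pi\<close>. That
  arc misses the point at time \<open>1\<close>. Recurrence to the point at time \<open>0\<close> would not suffice, because it
  is an endpoint of the arc: the angle could approach a full turn without reaching it.
\<close>

lemma increasing_recurrent_angle_exceeds_turn:
  fixes \<psi> :: "real \<Rightarrow> 'b::metric_space" and \<theta> :: "real \<Rightarrow> real"
  assumes cont: "continuous_on UNIV \<psi>"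
    and inj: "\<And>a b. a < b \<Longrightarrow> b < a + 2 * pi \<Longrightarrow> \<psi> a \<noteq> \<psi> b"
    and mono: "strict_mono_on {0..} \<theta>"
    and rec: "\<And>e. 0 < e \<Longrightarrow> \<exists>s\<ge>2. dist (\<psi> (\<theta> s)) (\<psi> (\<theta> 1)) < e"
  shows "\<exists>t\<ge>0. \<theta> 0 + 2 * pi \<le> \<theta> t"
proof (rule ccontr)
  assume neg: "\<not> ?thesis"
  have th: "\<theta> 0 < \<theta> 1" "\<theta> 1 < \<theta> 2" using mono by (auto simp: strict_mono_on_def)
  let ?K = "\<psi> ` {\<theta> 2..\<theta> 0 + 2 * pi}"
  have "closed ?K" by (intro compact_imp_closed compact_continuous_image continuous_on_subset[OF cont]) auto
  moreover have "\<psi> (\<theta> 1) \<notin> ?K"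
  proof
    assume "\<psi> (\<theta> 1) \<in> ?K"
    then obtain b where "b \<in> {\<theta> 2..\<theta> 0 + 2 * pi}" "\<psi> (\<theta> 1) = \<psi> b" by auto
    then show False using inj[of "\<theta> 1" b] th by auto
  qed
  ultimately obtain e where e: "0 < e" "ball (\<psi> (\<theta> 1)) e \<subseteq> - ?K"
    using open_contains_ball[of "- ?K"] by (meson ComplI open_Compl)
  obtain s where s: "2 \<le> s" "dist (\<psi> (\<theta> s)) (\<psi> (\<theta> 1)) < e" using rec[OF e(1)] by auto
  have "\<theta> 2 \<le> \<theta> s" using strict_mono_onD[OF mono, of 2 s] s(1) by (cases "s = 2") auto
  moreover have "\<theta> s \<le> \<theta> 0 + 2 * pi" using neg s(1) by (smt (verit))
  ultimately have "\<psi> (\<theta> s) \<in> ?K" by auto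
  moreover have "\<psi> (\<theta> s) \<in> ball (\<psi> (\<theta> 1)) e" using s(2) by (simp add: dist_commute)
  ultimately show False using e(2) by auto
qed

lemma recurrent_angle_makes_full_turn:
  fixes \<psi> :: "real \<Rightarrow> 'b::metric_space" and \<theta> :: "real \<Rightarrow> real"
  assumes cont: "continuous_on UNIV \<psi>"
    and inj: "\<And>a b. a < b \<Longrightarrow> b < a + 2 * pi \<Longrightarrow> \<psi> a \<noteq> \<psi> b"
    and cont_theta: "continuous_on {0..} \<theta>" and inj_theta: "inj_on \<theta> {0..}"
    and rec: "\<And>e. 0 < e \<Longrightarrow> \<exists>s\<ge>2. dist (\<psi> (\<theta> s)) (\<psi> (\<theta> 1)) < e"
  obtains T where "0 < T" "\<bar>\<theta> T - \<theta> 0\<bar> = 2 * pi"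
proof -
  have "strict_mono_on {0..} \<theta> \<or> strict_antimono_on {0..} \<theta>"
    using injective_eq_monotone_map[of "{0..}" \<theta>] cont_theta inj_theta by (simp add: is_interval_ci)
  then have "\<exists>t\<ge>0. 2 * pi \<le> \<bar>\<theta> t - \<theta> 0\<bar>"
  proof
    assume "strict_mono_on {0..} \<theta>"
    then show ?thesis using increasing_recurrent_angle_exceeds_turn[OF cont inj _ rec] by force
  next
    assume "strict_antimono_on {0..} \<theta>"
    then have "strict_mono_on {0..} (\<lambda>t. - \<theta> t)" by (auto simp: monotone_on_def)
    moreover have "continuous_on UNIV (\<lambda>a. \<psi> (- a))"
      by (intro continuous_on_compose2[OF cont] continuous_intros) auto
    moreover have "\<psi> (- a) \<noteq> \<psi> (- b)" if "a < b" "b < a + 2 * pi" for a b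
      using inj[of "- b" "- a"] that by auto
    ultimately have "\<exists>t\<ge>0. - \<theta> 0 + 2 * pi \<le> - \<theta> t"
      using increasing_recurrent_angle_exceeds_turn[of "\<lambda>a. \<psi> (- a)" "\<lambda>t. - \<theta> t"] rec by simp
    then show ?thesis by force
  qed
  then obtain t where t: "0 \<le> t" "2 * pi \<le> \<bar>\<theta> t - \<theta> 0\<bar>" by auto
  have "continuous_on {0..t} (\<lambda>s. \<bar>\<theta> s - \<theta> 0\<bar>)"
    by (intro continuous_intros continuous_on_subset[OF cont_theta]) auto
  then obtain T where T: "0 \<le> T" "T \<le> t" "\<bar>\<theta> T - \<theta> 0\<bar> = 2 * pi"
    using IVT'[of "\<lambda>s. \<bar>\<theta> s - \<theta> 0\<bar>" 0 "2 * pi" t] t by auto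
  then have "T \<noteq> 0" by auto
  with T show thesis by (intro that[of T]) auto
qed

definition polar_unit :: "real \<Rightarrow> real ^ 2" where
  "polar_unit a = vector [cos a, sin a]"

lemma polar_unit_nth [simp]: "polar_unit a $ 1 = cos a" "polar_unit a $ 2 = sin a"
  by (simp_all add: polar_unit_def)

lemma norm_polar_unit [simp]: "norm (polar_unit a) = 1"
  by (simp add: norm_vec_def L2_set_def UNIV_2)

lemma polar_unit_nonzero [simp]: "polar_unit a \<noteq> 0"
  using norm_polar_unit[of a] by force

lemma polar_unit_eq_iff: "polar_unit a = polar_unit b \<longleftrightarrow> (\<exists>n::int. a = b + of_int n * (2 * pi))"
proof -
  have "polar_unit a = polar_unit b \<longleftrightarrow> sin a = sin b \<and> cos a = cos b" by (auto simp: vec_eq_iff forall_2)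
  also have "\<dots> \<longleftrightarrow> (\<exists>n::int. a = b + of_int n * (2 * pi))"
    by (simp add: sin_cos_eq_iff mult_ac)
  finally show ?thesis .
qed

lemma continuous_on_polar_unit: "continuous_on S polar_unit"
proof -
  have polar_unit_axis: "polar_unit = (\<lambda>a. cos a *\<^sub>R axis 1 1 + sin a *\<^sub>R axis 2 1)"
    by (rule ext) (simp add: vec_eq_iff forall_2 axis_def)
  show ?thesis by (subst polar_unit_axis) (intro continuous_intros)
qed

text \<open>
  Read in the complex plane, \<open>u\<close> has a continuous logarithm on the convex set \<open>S\<close>; its
  imaginary part is the angle.
\<close>

lemma continuous_angle:
  fixes u :: "real \<Rightarrow> real ^ 2"
  assumes "continuous_on S u" "convex S" "\<And>t. t \<in> S \<Longrightarrow> u t \<noteq> 0"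
  obtains \<theta> where "continuous_on S \<theta>" "\<And>t. t \<in> S \<Longrightarrow> u t = norm (u t) *\<^sub>R polar_unit (\<theta> t)"
proof -
  let ?c = "\<lambda>t. Complex (u t $ 1) (u t $ 2)"
  have "continuous_on S (\<lambda>t. of_real (u t $ 1) + \<i> * of_real (u t $ 2))"
    by (intro continuous_intros assms)
  then have "continuous_on S ?c" by (simp add: Complex_eq)
  moreover have "?c t \<noteq> 0" if "t \<in> S" for t
    using assms(3)[OF that] by (auto simp: complex_eq_iff vec_eq_iff forall_2)
  ultimately obtain g where g: "continuous_on S g" "\<And>t. t \<in> S \<Longrightarrow> ?c t = exp (g t)"
    using continuous_logarithm_on_contractible[of S ?c] convex_imp_contractible[OF assms(2)] by blast
  have "u t = norm (u t) *\<^sub>R polar_unit (Im (g t))" if "t \<in> S" for t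
  proof -
    have "norm (u t) = cmod (?c t)"
      by (simp add: norm_vec_def L2_set_def UNIV_2 cmod_def)
    also have "\<dots> = exp (Re (g t))" using g(2)[OF that] by simp
    finally have "norm (u t) = exp (Re (g t))" .
    moreover have "u t $ 1 = exp (Re (g t)) * cos (Im (g t))" "u t $ 2 = exp (Re (g t)) * sin (Im (g t))"
      using g(2)[OF that] by (simp_all add: complex_eq_iff Re_exp Im_exp)
    ultimately show ?thesis by (simp add: vec_eq_iff forall_2)
  qed
  moreover have "continuous_on S (\<lambda>t. Im (g t))" by (intro continuous_intros g)
  ultimately show thesis using that by blast
qed

locale planar_nonexpansive_semiflow = nonexpansive_semiflow N f \<phi>
  for N :: "real ^ 2 \<Rightarrow> real" and f \<phi>
begin

text \<open>
  The orbit stays on the \<open>N\<close>-sphere around \<open>p\<close>, on which a point is determined by its angle. If the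
  angle \<open>\<theta>\<close> took a value twice, its horizontal chords would give \<open>\<phi> b z\<close> arbitrarily small
  return times and make it an equilibrium, which a nonequilibrium recurrent orbit cannot
  reach. So \<open>\<theta>\<close> is injective, recurrence forces a full turn, and after a full turn the orbit is back
  at \<open>z\<close> and has passed through every direction.
\<close>

lemma recurrent_orbit_fills_sphere:
  assumes rec: "omega_limit_point z z" and "f p = 0" and "f z \<noteq> 0"
  obtains T where "0 < T" "\<phi> T z = z"
    "\<And>q. N (q - p) = N (z - p) \<Longrightarrow> \<exists>t\<in>{0..T}. q = \<phi> t z"
proof -
  define r where "r = N (z - p)"
  have "0 < r" using assms by (auto simp: r_def intro: N_pos)
  have on_sphere: "N (\<phi> t z - p) = r" if "0 \<le> t" for t
    using recurrent_orbit_on_sphere[OF rec \<open>f p = 0\<close> that] by (simp add: r_def)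
  \<comment> \<open>the point of the \<open>N\<close>-sphere in direction \<open>polar_unit a\<close>\<close>
  define \<psi> where "\<psi> a = p + (r / N (polar_unit a)) *\<^sub>R polar_unit a" for a
  have N_polar_unit: "0 < N (polar_unit a)" for a by (simp add: N_pos)
  have cont_psi: "continuous_on UNIV \<psi>"
    unfolding \<psi>_def using N_polar_unit
    by (intro continuous_intros continuous_on_polar_unit) (auto simp: less_imp_neq[THEN not_sym])
  have psi_eq_iff: "\<psi> a = \<psi> b \<longleftrightarrow> polar_unit a = polar_unit b" for a b
  proof
    assume "\<psi> a = \<psi> b"
    then have eq: "(r / N (polar_unit a)) *\<^sub>R polar_unit a = (r / N (polar_unit b)) *\<^sub>R polar_unit b" by (simp add: \<psi>_def)
    then have "norm ((r / N (polar_unit a)) *\<^sub>R polar_unit a) = norm ((r / N (polar_unit b)) *\<^sub>R polar_unit b)" by simp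
    then have "r / N (polar_unit a) = r / N (polar_unit b)" using \<open>0 < r\<close> N_polar_unit[of a] N_polar_unit[of b] by simp
    moreover have "r / N (polar_unit b) \<noteq> 0" using \<open>0 < r\<close> N_polar_unit[of b] by simp
    ultimately show "polar_unit a = polar_unit b" using eq by simp
  qed (simp add: \<psi>_def)
  have psi_polar: "q = \<psi> a" if "N (q - p) = r" "q - p = norm (q - p) *\<^sub>R polar_unit a" for q a
  proof -
    have "r = norm (q - p) * N (polar_unit a)" using that by (metis N_scale abs_norm_cancel)
    then show ?thesis using that(2) N_polar_unit[of a] by (simp add: \<psi>_def field_simps)
  qed
  obtain \<theta> where cont_theta: "continuous_on {0..} \<theta>"
    and theta: "\<And>t. 0 \<le> t \<Longrightarrow> \<phi> t z - p = norm (\<phi> t z - p) *\<^sub>R polar_unit (\<theta> t)"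
  proof (rule continuous_angle[of "{0..}" "\<lambda>t. \<phi> t z - p"])
    show "continuous_on {0..} (\<lambda>t. \<phi> t z - p)"
      by (intro continuous_intros continuous_on_flow_time)
    show "\<phi> t z - p \<noteq> 0" if "t \<in> {0..}" for t using on_sphere[of t] \<open>0 < r\<close> that by auto
  qed (auto simp: is_interval_ci is_interval_convex)
  have orbit: "\<phi> t z = \<psi> (\<theta> t)" if "0 \<le> t" for t
    using psi_polar[OF on_sphere[OF that] theta[OF that]] .
  have "inj_on \<theta> {0..}"
  proof (rule linorder_inj_onI')
    fix a b :: real
    assume "a \<in> {0..}" "b \<in> {0..}" "a < b"
    show "\<theta> a \<noteq> \<theta> b"
    proof
      assume "\<theta> a = \<theta> b"
      have "\<phi> ((b - a) / 2 ^ n) (\<phi> b z) = \<phi> b z" for n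
      proof -
        define h where "h = (b - a) / 2 ^ n"
        have "0 \<le> h" using \<open>a < b\<close> by (simp add: h_def)
        obtain c where c: "a \<le> c" "c + h \<le> b" "\<theta> c = \<theta> (c + h)"
          using equal_endpoints_imp_halving_chords[of a b \<theta> n] \<open>a < b\<close> \<open>\<theta> a = \<theta> b\<close> \<open>a \<in> {0..}\<close>
            continuous_on_subset[OF cont_theta] by (auto simp: h_def)
        have "0 \<le> c" using c \<open>a \<in> {0..}\<close> by simp
        have "\<phi> h (\<phi> c z) = \<phi> c z"
          using orbit[of c] orbit[of "c + h"] c(3) \<open>0 \<le> c\<close> \<open>0 \<le> h\<close> flow_add[of c h z] by simp
        moreover have "\<phi> (b - c) (\<phi> h (\<phi> c z)) = \<phi> h (\<phi> (b - c) (\<phi> c z))"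
          using flow_add[of h "b - c" "\<phi> c z"] flow_add[of "b - c" h "\<phi> c z"] c \<open>0 \<le> h\<close> by (simp add: add.commute)
        moreover have "\<phi> (b - c) (\<phi> c z) = \<phi> b z"
          using flow_add[of c "b - c" z] c \<open>0 \<le> c\<close> \<open>0 \<le> h\<close> by simp
        ultimately show ?thesis by (simp add: h_def)
      qed
      then have "f (\<phi> b z) = 0" using equilibrium_if_small_returns[of "b - a"] \<open>a < b\<close> by simp
      then show False using recurrent_orbit_avoids_equilibria[OF rec] \<open>b \<in> {0..}\<close> \<open>f z \<noteq> 0\<close> by auto
    qed
  qed
  moreover have "\<exists>s\<ge>2. dist (\<psi> (\<theta> s)) (\<psi> (\<theta> 1)) < e" if e: "0 < e" for e
  proof -
    obtain d where d: "0 < d" "\<And>x y. N (x - y) < d \<Longrightarrow> dist x y < e"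
      using dist_le_of_N_small[OF e] by blast
    obtain s where s: "1 \<le> s" "N (\<phi> s z - z) < d" using omega_limit_pointE[OF rec d(1), of 1] by blast
    have "N (\<phi> (s + 1) z - \<phi> 1 z) < d"
      using flow_add[of s 1 z] nonexpansive[of 1 "\<phi> s z" z] s by simp
    then show ?thesis using d(2) orbit[of "s + 1"] orbit[of 1] s(1) by (intro exI[of _ "s + 1"]) auto
  qed
  moreover have "\<psi> a \<noteq> \<psi> b" if "a < b" "b < a + 2 * pi" for a b
  proof
    assume "\<psi> a = \<psi> b"
    then obtain n :: int where n: "b = a + of_int n * (2 * pi)" by (metis psi_eq_iff polar_unit_eq_iff)
    then have "0 < real_of_int n" "real_of_int n < 1" using that pi_gt_zero
      by (simp_all add: zero_less_mult_iff mult_less_cancel_right_disj)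
    then show False by simp
  qed
  ultimately obtain T where T: "0 < T" "\<bar>\<theta> T - \<theta> 0\<bar> = 2 * pi"
    using recurrent_angle_makes_full_turn[OF cont_psi _ cont_theta] by metis
  have "polar_unit (\<theta> T) = polar_unit (\<theta> 0)"
  proof (cases "0 \<le> \<theta> T - \<theta> 0")
    case True
    then show ?thesis using T(2) by (auto simp: polar_unit_eq_iff intro!: exI[of _ 1])
  next
    case False
    then show ?thesis using T(2) by (auto simp: polar_unit_eq_iff intro!: exI[of _ "-1"])
  qed
  then have "\<phi> T z = z" using orbit[of T] orbit[of 0] T(1) by (simp add: psi_eq_iff)
  moreover have "\<exists>t\<in>{0..T}. q = \<phi> t z" if "N (q - p) = N (z - p)" for q
  proof -
    have "q - p \<noteq> 0" using that \<open>0 < r\<close> by (auto simp: r_def)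
    then obtain a where a: "q - p = norm (q - p) *\<^sub>R polar_unit a"
      using continuous_angle[of "{0}" "\<lambda>_. q - p"] by auto
    define m where "m = min (\<theta> 0) (\<theta> T)"
    \<comment> \<open>shift the angle \<open>a\<close> of \<open>q\<close> by full turns into the range swept out up to time \<open>T\<close>\<close>
    obtain k :: int where "of_int k \<le> (a - m) / (2 * pi)" "(a - m) / (2 * pi) < of_int k + 1"
      using floor_exists[of "(a - m) / (2 * pi)"] by (metis of_int_1 of_int_add)
    then have k: "of_int k * (2 * pi) \<le> a - m" "a - m < (of_int k + 1) * (2 * pi)"
      using pi_gt_zero by (simp_all add: field_simps)
    define b where "b = a + of_int (- k) * (2 * pi)"
    have "m \<le> b" "b \<le> m + 2 * pi" using k by (simp_all add: b_def algebra_simps)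
    moreover have "connected (\<theta> ` {0..T})"
      by (intro connected_continuous_image continuous_on_subset[OF cont_theta]) auto
    moreover have "m \<in> \<theta> ` {0..T}" "m + 2 * pi \<in> \<theta> ` {0..T}"
      using T by (auto simp: m_def min_def abs_if image_iff split: if_splits intro: bexI[of _ 0] bexI[of _ T])
    ultimately have "b \<in> \<theta> ` {0..T}" unfolding connected_iff_interval by blast
    then obtain t where t: "t \<in> {0..T}" "b = \<theta> t" by auto
    have "polar_unit b = polar_unit a" unfolding polar_unit_eq_iff b_def by blast
    then have "q = \<phi> t z"
      using psi_polar[of q a] that a t orbit[of t] psi_eq_iff[of a b] by (simp add: r_def)
    then show ?thesis using t(1) by auto
  qed
  ultimately show thesis using that T(1) by blast
qed

section \<open>The linear field inside a recurrent sphere\<close>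

text \<open>
  The flow acts on the ball around \<open>p\<close> through \<open>z\<close> by isometries that fix \<open>p\<close>, so it commutes with
  halving the distance to \<open>p\<close>, and so does its generator \<open>f\<close>. A map that commutes with halving
  coincides with its derivative at the center.
\<close>

lemma linear_inside_recurrent_sphere:
  assumes rec: "omega_limit_point z z" and "f p = 0" and "f z \<noteq> 0"
    and deriv: "(f has_derivative A) (at p)" and "N y \<le> N (z - p)"
  shows "f (p + y) = A y"
proof -
  let ?B = "{q. N (q - p) \<le> N (z - p)}"
  obtain T where T: "0 < T" "\<phi> T z = z"
    and fills: "\<And>q. N (q - p) = N (z - p) \<Longrightarrow> \<exists>t\<in>{0..T}. q = \<phi> t z"
    using recurrent_orbit_fills_sphere[OF rec \<open>f p = 0\<close> \<open>f z \<noteq> 0\<close>] by blast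
  have into: "\<phi> t ` ?B \<subseteq> ?B" if "0 \<le> t" for t
    using nonexpansive[OF that, of _ p] flow_equilibrium[OF \<open>f p = 0\<close> that] by (auto intro: order_trans)
  have "\<phi> T q = q" if sphere: "N (q - p) = N (z - p)" for q
  proof -
    obtain t where t: "0 \<le> t" "q = \<phi> t z" using fills[OF sphere] by auto
    then show ?thesis using flow_add[of t T z] flow_add[of T t z] T by (simp add: add.commute)
  qed
  then have "?B \<subseteq> \<phi> T ` ?B"
    using sphere_fixing_map_surjective[OF continuous_on_flow, of T p "N (z - p)"] T(1)
    by (smt (verit) image_eqI mem_Collect_eq subsetI)
  then have surj_T: "\<phi> T ` ?B = ?B" using into[of T] T(1) by auto
  have iso_T: "N (\<phi> T a - \<phi> T b) = N (a - b)" if "a \<in> ?B" "b \<in> ?B" for a b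
    by (rule surjective_nonexpansive_isometry[OF compact_N_cball surj_T _ that])
      (use nonexpansive T(1) in auto)
  have halve_flow: "\<phi> h (midpoint a p) = midpoint (\<phi> h a) p" if h: "0 \<le> h" "h \<le> T" and a: "a \<in> ?B" for h a
  proof (rule ball_isometry_preserves_midpoint)
    \<comment> \<open>as \<open>\<phi> T\<close> factors through \<open>\<phi> h\<close> on either side, \<open>\<phi> h\<close> inherits surjectivity and isometry\<close>
    have split: "\<phi> T = \<phi> (T - h) \<circ> \<phi> h" "\<phi> T = \<phi> h \<circ> \<phi> (T - h)"
      using flow_add[of h "T - h"] flow_add[of "T - h" h] h by (auto simp: fun_eq_iff)
    show "\<phi> h ` ?B = ?B"
    proof
      have "?B = \<phi> h ` \<phi> (T - h) ` ?B" using surj_T by (simp only: split(2) image_comp)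
      also have "\<dots> \<subseteq> \<phi> h ` ?B" using into[of "T - h"] h by (intro image_mono) auto
      finally show "?B \<subseteq> \<phi> h ` ?B" .
    qed (rule into[OF h(1)])
    show "N (\<phi> h x - \<phi> h y) = N (x - y)" if "N (x - p) \<le> N (z - p)" "N (y - p) \<le> N (z - p)" for x y
      using iso_T[of x y] nonexpansive[of h x y] nonexpansive[of "T - h" "\<phi> h x" "\<phi> h y"] that h
      unfolding split(1) by simp
  qed (use a h flow_equilibrium \<open>f p = 0\<close> in auto)
  have quotient: "((\<lambda>h. (\<phi> h q - q) /\<^sub>R h) \<longlongrightarrow> f q) (at_right 0)" for q
    using has_vector_derivative_right_quotient[OF flow_deriv[of 0 q]] by simp
  have halve: "f (p + (1/2) *\<^sub>R w) = (1/2) *\<^sub>R f (p + w)" if "N w \<le> N (z - p)" for w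
  proof -
    have half: "midpoint q p = p + (1/2) *\<^sub>R (q - p)" for q
      by (simp add: midpoint_def vec_eq_iff field_simps)
    have "((\<lambda>h. (1/2) *\<^sub>R ((\<phi> h (p + w) - (p + w)) /\<^sub>R h)) \<longlongrightarrow> (1/2) *\<^sub>R f (p + w)) (at_right 0)"
      by (intro tendsto_intros quotient)
    moreover have "\<forall>\<^sub>F h in at_right 0. (1/2) *\<^sub>R ((\<phi> h (p + w) - (p + w)) /\<^sub>R h)
        = (\<phi> h (p + (1/2) *\<^sub>R w) - (p + (1/2) *\<^sub>R w)) /\<^sub>R h"
      using eventually_at_right_real[OF T(1)]
    proof eventually_elim
      case (elim h)
      have "\<phi> h (p + (1/2) *\<^sub>R w) = p + (1/2) *\<^sub>R (\<phi> h (p + w) - p)"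
        using halve_flow[of h "p + w"] elim that by (simp add: half)
      then have "\<phi> h (p + (1/2) *\<^sub>R w) - (p + (1/2) *\<^sub>R w) = (1/2) *\<^sub>R (\<phi> h (p + w) - (p + w))"
        by (simp add: vec_eq_iff field_simps)
      then show ?case by simp
    qed
    ultimately have "((\<lambda>h. (\<phi> h (p + (1/2) *\<^sub>R w) - (p + (1/2) *\<^sub>R w)) /\<^sub>R h) \<longlongrightarrow> (1/2) *\<^sub>R f (p + w)) (at_right 0)"
      by (rule Lim_transform_eventually)
    then show ?thesis using tendsto_unique[OF _ quotient] by fastforce
  qed
  have halves: "f (p + (1 / 2 ^ n) *\<^sub>R y) = (1 / 2 ^ n) *\<^sub>R f (p + y)" for n
  proof (induction n)
    case (Suc n)
    have "N y / 2 ^ n \<le> N y" using mult_left_mono[of 1 "2 ^ n" "N y"] by (simp add: divide_le_eq)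
    then have "N ((1 / 2 ^ n) *\<^sub>R y) \<le> N (z - p)" using \<open>N y \<le> N (z - p)\<close> by simp
    from halve[OF this] show ?case using Suc by simp
  qed simp
  have "((\<lambda>s. f (p + s *\<^sub>R y)) has_vector_derivative A y) (at 0 within {0..})"
  proof -
    have "((\<lambda>s. p + s *\<^sub>R y) has_derivative (\<lambda>s. s *\<^sub>R y)) (at 0 within {0..})"
      by (auto intro!: derivative_eq_intros)
    from has_derivative_compose[OF this, of f A] deriv show ?thesis
      using linear_scale[OF has_derivative_linear[OF deriv]] by (simp add: has_vector_derivative_def)
  qed
  from has_vector_derivative_right_quotient[OF this]
  have "((\<lambda>s. f (p + s *\<^sub>R y) /\<^sub>R s) \<longlongrightarrow> A y) (at_right 0)" using \<open>f p = 0\<close> by simp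
  moreover have "filterlim (\<lambda>n::nat. 1 / 2 ^ n :: real) (at_right 0) sequentially"
    using LIMSEQ_divide_realpow_zero[of 2 1] by (intro tendsto_imp_filterlim_at_right) auto
  ultimately have "(\<lambda>n::nat. f (p + (1 / 2 ^ n) *\<^sub>R y) /\<^sub>R (1 / 2 ^ n)) \<longlonglongrightarrow> A y"
    by (rule filterlim_compose)
  then have "(\<lambda>n::nat. f (p + y)) \<longlonglongrightarrow> A y" by (simp add: halves)
  then show ?thesis using LIMSEQ_unique tendsto_const by blast
qed

text \<open>
  Along the orbit \<open>u' = A u\<close>, and the form \<open>Q w = det (w, A w)\<close> satisfies
  \<open>Q(u)' = (trace A) Q(u)\<close>, because \<open>A u' = A (A u)\<close> and, by Cayley-Hamilton,
  \<open>A (A u)\<close> is \<open>trace A\<close> times \<open>A u\<close> minus \<open>det A\<close> times \<open>u\<close>. Since \<open>u\<close> is periodic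
  and runs through the whole sphere, \<open>Q\<close> is constant there, and by homogeneity it is
  proportional to \<open>N\<^sup>2\<close> everywhere.
\<close>

lemma nonequilibrium_recurrence_imp_weighted_l2:
  assumes rec: "omega_limit_point z z" and "f p = 0" and "f z \<noteq> 0"
    and deriv: "(f has_derivative A) (at p)"
  shows "weighted_l2_norm N"
proof -
  define r where "r = N (z - p)"
  have "0 < r" using assms by (auto simp: r_def intro: N_pos)
  obtain T where T: "0 < T" "\<phi> T z = z"
    and fills: "\<And>q. N (q - p) = r \<Longrightarrow> \<exists>t\<in>{0..T}. q = \<phi> t z"
    using recurrent_orbit_fills_sphere[OF rec \<open>f p = 0\<close> \<open>f z \<noteq> 0\<close>] unfolding r_def by blast
  interpret A: linear A using deriv by (rule has_derivative_linear)
  define a b c d where "a = A (axis 1 1) $ 1" and "b = A (axis 2 1) $ 1"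
    and "c = A (axis 1 1) $ 2" and "d = A (axis 2 1) $ 2"
  have A: "A w $ 1 = a * w $ 1 + b * w $ 2" "A w $ 2 = c * w $ 1 + d * w $ 2" for w
  proof -
    have "w = (w $ 1) *\<^sub>R axis 1 1 + (w $ 2) *\<^sub>R axis 2 1"
      by (simp add: vec_eq_iff forall_2 axis_def)
    then have "A w = A ((w $ 1) *\<^sub>R axis 1 1 + (w $ 2) *\<^sub>R axis 2 1)" by (rule arg_cong)
    then have "A w = (w $ 1) *\<^sub>R A (axis 1 1) + (w $ 2) *\<^sub>R A (axis 2 1)"
      by (simp only: A.add A.scale)
    then show "A w $ 1 = a * w $ 1 + b * w $ 2" "A w $ 2 = c * w $ 1 + d * w $ 2"
      by (simp_all add: a_def b_def c_def d_def)
  qed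
  define u where "u t = \<phi> t z - p" for t
  have sphere: "N (u t) = r" if "0 \<le> t" for t
    using recurrent_orbit_on_sphere[OF rec \<open>f p = 0\<close> that] by (simp add: u_def r_def)
  have uT: "u T = u 0" using T by (simp add: u_def)
  have "(u has_vector_derivative A (u t)) (at t within {0..})" if "0 \<le> t" for t
  proof -
    have "f (\<phi> t z) = A (u t)"
      using linear_inside_recurrent_sphere[OF rec \<open>f p = 0\<close> \<open>f z \<noteq> 0\<close> deriv, of "u t"] sphere[OF that]
      by (simp add: r_def) (simp add: u_def)
    then show ?thesis using flow_deriv[OF that, of z] unfolding u_def
      by (auto intro!: derivative_eq_intros)
  qed
  then have u': "((\<lambda>t. u t $ i) has_real_derivative A (u t) $ i) (at t within {0..})" if "0 \<le> t" for t i
    unfolding has_real_derivative_iff_has_vector_derivative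
    by (rule bounded_linear.has_vector_derivative[OF bounded_linear_vec_nth]) (use that in auto)
  define Q where "Q w = w $ 1 * A w $ 2 - w $ 2 * A w $ 1" for w
  have Q: "Q w = c * (w $ 1)\<^sup>2 + (d - a) * (w $ 1 * w $ 2) - b * (w $ 2)\<^sup>2" for w
    unfolding Q_def A by (simp add: algebra_simps power2_eq_square)
  have Q_deriv: "((\<lambda>t. Q (u t)) has_real_derivative (a + d) * Q (u t)) (at t within {0..})" if "0 \<le> t" for t
  proof -
    have "((\<lambda>t. Q (u t)) has_real_derivative 2 * c * u t $ 1 * A (u t) $ 1
        + (d - a) * (A (u t) $ 1 * u t $ 2 + u t $ 1 * A (u t) $ 2)
        + 2 * (- b) * u t $ 2 * A (u t) $ 2) (at t within {0..})"
      using binary_quadratic_form_has_derivative[OF u'[OF that] u'[OF that], of c 1 "d - a" 2 "- b"]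
      by (simp add: Q)
    then show ?thesis
      by (rule DERIV_cong) (simp add: Q A algebra_simps power2_eq_square)
  qed
  have Q_orbit: "Q (u t) = Q (u 0)" if "0 \<le> t" for t
    by (rule returning_linear_growth(2)[of "\<lambda>t. Q (u t)", OF Q_deriv \<open>0 < T\<close> _ that]) (simp_all add: uT)
  have Q_scale: "Q (s *\<^sub>R w) = s\<^sup>2 * Q w" for s w
    by (simp add: Q algebra_simps power2_eq_square)
  have Q_N: "r\<^sup>2 * Q w = (N w)\<^sup>2 * Q (u 0)" for w
  proof (cases "w = 0")
    case False
    then have "0 < N w" by (rule N_pos)
    define v where "v = (r / N w) *\<^sub>R w"
    have "N v = r" using False \<open>0 < r\<close> by (simp add: v_def)
    then obtain t where "0 \<le> t" "p + v = \<phi> t z" using fills[of "p + v"] by auto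
    then have "Q v = Q (u 0)" using Q_orbit[of t] by (metis add_diff_cancel_left' u_def)
    then show ?thesis using False unfolding v_def Q_scale by (simp add: field_simps)
  qed (simp add: Q)
  have "Q (u 0) \<noteq> 0"
  proof
    assume "Q (u 0) = 0"
    \<comment> \<open>every vector is then an eigenvector, so \<open>A\<close> is a multiple of the identity; the squared
      Euclidean length of the orbit is then both exponential and periodic, which leaves
      only \<open>A = 0\<close>\<close>
    then have Q0: "Q w = 0" for w using Q_N[of w] \<open>0 < r\<close> by simp
    have "b = 0" "c = 0" using Q0[of "axis 2 1"] Q0[of "axis 1 1"] by (simp_all add: Q axis_def)
    moreover have "d = a" using Q0[of "axis 1 1 + axis 2 1"] \<open>b = 0\<close> \<open>c = 0\<close> by (simp add: Q axis_def)
    ultimately have A_scale: "A w = a *\<^sub>R w" for w by (simp add: vec_eq_iff forall_2 A)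
    define g where "g t = (u t $ 1)\<^sup>2 + (u t $ 2)\<^sup>2" for t
    have g_deriv: "(g has_real_derivative (2 * a) * g t) (at t within {0..})" if "0 \<le> t" for t
    proof -
      have "(g has_real_derivative 2 * u t $ 1 * A (u t) $ 1 + 2 * u t $ 2 * A (u t) $ 2) (at t within {0..})"
        using binary_quadratic_form_has_derivative[OF u'[OF that] u'[OF that], of 1 1 0 2 1]
        by (simp add: g_def[abs_def])
      then show ?thesis
        by (rule DERIV_cong) (simp add: g_def A_scale algebra_simps power2_eq_square)
    qed
    have "a = 0 \<or> g 0 = 0"
      using returning_linear_growth(1)[of g, OF g_deriv \<open>0 < T\<close>] uT by (simp add: g_def)
    moreover have "g 0 \<noteq> 0"
    proof
      assume "g 0 = 0"
      then have "u 0 = 0" by (simp add: g_def vec_eq_iff forall_2 sum_power2_eq_zero_iff)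
      then show False using sphere[of 0] \<open>0 < r\<close> by simp
    qed
    ultimately have "f (p + (z - p)) = 0"
      using linear_inside_recurrent_sphere[OF rec \<open>f p = 0\<close> \<open>f z \<noteq> 0\<close> deriv, of "z - p"] A_scale by simp
    then show False using \<open>f z \<noteq> 0\<close> by simp
  qed
  \<comment> \<open>\<open>P\<close> is the symmetric matrix of the form \<open>k * Q\<close>\<close>
  define k where "k = r\<^sup>2 / Q (u 0)"
  define P :: "real ^ 2 ^ 2" where
    "P = vector [vector [k * c, k * (d - a) / 2], vector [k * (d - a) / 2, - (k * b)]]"
  have P: "w \<bullet> (P *v w) = (N w)\<^sup>2" for w
  proof -
    have "w \<bullet> (P *v w) = k * Q w"
      unfolding P_def Q by (simp add: inner_vec_def matrix_vector_mult_def sum_2 algebra_simps power2_eq_square)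
    also have "\<dots> = r\<^sup>2 * Q w / Q (u 0)" by (simp add: k_def)
    also have "\<dots> = (N w)\<^sup>2" unfolding Q_N using \<open>Q (u 0) \<noteq> 0\<close> by simp
    finally show ?thesis .
  qed
  have "transpose P = P" by (simp add: P_def vec_eq_iff forall_2 transpose_def)
  then have "sym_pos_def P" by (simp add: sym_pos_def_def P)
  moreover have "N w = sqrt (w \<bullet> (P *v w))" for w by (simp add: P)
  ultimately show ?thesis unfolding weighted_l2_norm_def by blast
qed

end

section \<open>Convergence to equilibria\<close>

text \<open>
  If the distance to the equilibria did not tend to zero, the trajectory would have an
  \<open>\<omega>\<close>-limit point at positive distance from them. Such a point would be a recurrent
  nonequilibrium.
\<close>

theorem lemma18:
  fixes f :: "real ^ 2 \<Rightarrow> real ^ 2"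
    and \<phi> :: "real \<Rightarrow> real ^ 2 \<Rightarrow> real ^ 2"
    and N :: "real ^ 2 \<Rightarrow> real"
    and x :: "real ^ 2"
  assumes "C1_vector_field f"
    and "forward_flow f \<phi>"
    and "is_norm N"
    and "\<not> weighted_l2_norm N"
    and "nonexpansive_flow N \<phi>"
    and "bounded {\<phi> t x | t. t \<ge> 0}"
  shows "converges_to_set (\<lambda>t. \<phi> t x) (equilibria f)"
proof -
  interpret planar_nonexpansive_semiflow N f \<phi>
    using assms by unfold_locales
  obtain p where "f p = 0" using equilibrium_exists[OF assms(6)] .
  obtain A where deriv: "(f has_derivative A) (at p)"
    using assms(1) unfolding C1_vector_field_def by blast
  have limit_equilibrium: "z \<in> equilibria f" if "omega_limit_point x z" for z
  proof (rule ccontr)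
    assume "z \<notin> equilibria f"
    then have "f z \<noteq> 0" by (simp add: equilibria_def)
    from nonequilibrium_recurrence_imp_weighted_l2[OF omega_limit_point_recurrent[OF that] \<open>f p = 0\<close> this deriv]
    show False using assms(4) by contradiction
  qed
  have "((\<lambda>t. infdist (\<phi> t x) (equilibria f)) \<longlongrightarrow> 0) at_top"
  proof (rule ccontr)
    assume "\<not> ?thesis"
    then obtain e where "0 < e" and e: "\<And>b. \<exists>t\<ge>b. e \<le> infdist (\<phi> t x) (equilibria f)"
      unfolding tendsto_iff eventually_at_top_linorder dist_real_def diff_0_right
        abs_of_nonneg[OF infdist_nonneg] by (meson not_less)
    then have "\<forall>n. \<exists>t. real n \<le> t \<and> e \<le> infdist (\<phi> t x) (equilibria f)" by (intro allI e)
    then obtain t where t: "\<And>n. real n \<le> t n" "\<And>n. e \<le> infdist (\<phi> (t n) x) (equilibria f)"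
      unfolding choice_iff by blast
    have t_nonneg: "0 \<le> t n" for n using t(1)[of n] by linarith
    have "seq_compact (closure {\<phi> t x | t. t \<ge> 0})"
      using assms(6) by (simp add: compact_imp_seq_compact)
    moreover have "\<forall>n. \<phi> (t n) x \<in> closure {\<phi> t x | t. t \<ge> 0}"
      using t_nonneg by (auto intro!: closure_subset[THEN subsetD])
    ultimately obtain z s where s: "strict_mono s" "(\<lambda>n. \<phi> (t (s n)) x) \<longlonglongrightarrow> z"
      by (elim seq_compactE) (simp_all add: o_def)
    have "omega_limit_point x z"
      unfolding omega_limit_point_def
    proof (intro allI impI)
      fix \<epsilon> t0 :: real
      assume "0 < \<epsilon>"
      have "(\<lambda>n. N (\<phi> (t (s n)) x - z)) \<longlonglongrightarrow> N (z - z)" by (intro tendsto_N tendsto_diff s tendsto_const)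
      then have "\<forall>\<^sub>F n in sequentially. N (\<phi> (t (s n)) x - z) < \<epsilon>"
        using \<open>0 < \<epsilon>\<close> by (intro order_tendstoD(2)) auto
      moreover have "\<forall>\<^sub>F n in sequentially. t0 \<le> real n"
        using filterlim_real_sequentially unfolding filterlim_at_top by blast
      ultimately have "\<forall>\<^sub>F n in sequentially. N (\<phi> (t (s n)) x - z) < \<epsilon> \<and> t0 \<le> real n"
        by (rule eventually_conj)
      then obtain n where n: "N (\<phi> (t (s n)) x - z) < \<epsilon>" "t0 \<le> real n"
        unfolding eventually_sequentially by blast
      have "t0 \<le> t (s n)" using n(2) t(1)[of "s n"] seq_suble[OF s(1), of n] by linarith
      then show "\<exists>t\<ge>t0. 0 \<le> t \<and> N (\<phi> t x - z) < \<epsilon>" using n t_nonneg by (intro exI[of _ "t (s n)"]) simp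
    qed
    then have "infdist z (equilibria f) = 0" by (intro infdist_zero limit_equilibrium)
    moreover have "(\<lambda>n. infdist (\<phi> (t (s n)) x) (equilibria f)) \<longlonglongrightarrow> infdist z (equilibria f)"
      by (intro tendsto_infdist s)
    then have "e \<le> infdist z (equilibria f)" by (rule LIMSEQ_le_const) (use t(2) in auto)
    ultimately show False using \<open>0 < e\<close> by simp
  qed
  moreover have "equilibria f \<noteq> {}" using \<open>f p = 0\<close> by (auto simp: equilibria_def)
  ultimately show ?thesis by (simp add: converges_to_set_def)
qed

end
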